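(* Let $\mathcal{R}_{\text{BL}} \cup \mathcal{R}_{\text{TL}}$ be the range family of all bottomless and topless rectangles in $\mathbb{R}^2$ and let $m$ be a positive integer. Then for any finite point set $V \subset \mathbb{R}^2$ in general position, the hypergraph $\mathcal{H}(V,\mathcal{R}_{\text{BL}} \cup \mathcal{R}_{\text{TL}},m)$ admits a $21$-shallow hitting set $X \subseteq V$.
   Context: The family of all bottomless rectangles is $\mathcal{R}_{\text{BL}} = \{ [a,b] \times (-\infty,c] \mid a,b,c \in \mathbb{R} \}$ and the family of all topless rectangles is $\mathcal{R}_{\text{TL}} = \{ [a,b] \times [c,\infty) \mid a,b,c \in \mathbb{R} \}$. For a range family $\mathcal{R}$ (a family of subsets of $\mathbb{R}^2$), a finite point set $V \subset \mathbb{R}^2$ and a positive integer $m$, $\mathcal{H}(V,\mathcal{R},m)$ is the hypergraph with vertex set $V$ whose hyperedges are exactly the subsets $e \subseteq V$ with $|e| = m$ for which there is some $R \in \mathcal{R}$ with $e = V \cap R$. General position means that distinct points of $V$ have different $x$-coordinates and different $y$-coordinates. For a hypergraph with vertex set $V$ and hyperedge set $E$ and a positive integer $t$, a $t$-shallow hitting set is a subset $X \subseteq V$ with $1 \leq |e \cap X| \leq t$ for every $e \in E$. *)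

theory Defs
  imports Complex_Main
begin

type_synonym point = "real \<times> real"

type_synonym 'a hypergraph = "'a set \<times> 'a set set"

definition bottomless_rectangles :: "point set set" where
  "bottomless_rectangles = {{a..b} \<times> {..c} | a b c. True}"

definition topless_rectangles :: "point set set" where
  "topless_rectangles = {{a..b} \<times> {c..} | a b c. True}"

definition range_hypergraph :: "point set \<Rightarrow> point set set \<Rightarrow> nat \<Rightarrow> point hypergraph" where
  "range_hypergraph V \<R> m = (V, {e. e \<subseteq> V \<and> card e = m \<and> (\<exists>R\<in>\<R>. e = V \<inter> R)})"

definition general_position :: "point set \<Rightarrow> bool" where
  "general_position V \<longleftrightarrow>
     (\<forall>p\<in>V. \<forall>q\<in>V. p \<noteq> q \<longrightarrow> fst p \<noteq> fst q \<and> snd p \<noteq> snd q)"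

definition shallow_hitting_set :: "nat \<Rightarrow> 'a hypergraph \<Rightarrow> 'a set \<Rightarrow> bool" where
  "shallow_hitting_set t H X \<longleftrightarrow>
     X \<subseteq> fst H \<and> (\<forall>e\<in>snd H. 1 \<le> card (e \<inter> X) \<and> card (e \<inter> X) \<le> t)"

end

theory Submission
  imports Defs
begin

text \<open>
  Read the second coordinate as the time at which a point is inserted on the line, at the
  position given by its first coordinate. A bottomless edge then consists of \<open>m\<close> points that
  are consecutive among those inserted up to some time (an early edge), and a topless edge of
  \<open>m\<close> points that are consecutive among those inserted from some time on (a late edge). It is
  enough to find a set that meets every early edge, in at most \<open>9\<close> points, and every late edge
  in at most \<open>12\<close> points: the union of such a set with the one obtained from the reflected
  point set has at least one and at most \<open>9 + 12 = 21\<close> points in each edge.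

  The set is selected while the points arrive. Put \<open>L = (m - 1) div 5\<close>. The points selected so
  far cut the line into gaps. When a gap holds \<open>4 * L + 1\<close> points, one of these is selected,
  with at least \<open>L\<close> points on either side, unless the gap never receives \<open>m\<close> points: such a gap
  contains no early edge and is left alone. So every early edge is hit. Two features keep the
  number of selected points low.

  The first is a stock of candidates in each gap, from which the selected point is taken. The
  candidates meet every run of \<open>2 * L + 1\<close> consecutive points of the gap, in particular the
  middle run at the moment of splitting. A point can become a candidate only on its arrival, and
  the stock is thinned all the time to a minimal set with this property. Minimality leaves at
  most two candidates in a gap, none in a gap with at most \<open>2 * L\<close> points. Hence, at any time, the
  points present in a gap that will ever be selected are at most two. As the gaps have at
  least \<open>L\<close> points each, this bounds the selected points of an early edge
  (\<open>selects_early_card\<close>).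

  The second is that a gap splits at \<open>4 * L + 1\<close> points only if it receives at least
  \<open>m - (4 * L + 1) \<ge> L\<close> further points. Because of this, inside an interval \<open>J\<close> the late selected
  points are paid for by late points, \<open>L + 1\<close> of them for each. The only exceptions are the gaps
  that contain an end of \<open>J\<close>: a splitting sequence that closes in on that end can reuse the
  points that were there before, but these are at most \<open>4 * L\<close> per end. So a late edge with \<open>k\<close>
  selected points satisfies \<open>k * (L + 1) \<le> m + 2 * (4 * L) < 13 * (L + 1)\<close>
  (\<open>selects_late_card\<close>).
\<close>

section \<open>Intervals on the line\<close>

definition left_of :: "('a \<Rightarrow> real) \<Rightarrow> 'a set \<Rightarrow> 'a \<Rightarrow> 'a set" where
  "left_of x G q = {p \<in> G. x p < x q}"

definition right_of :: "('a \<Rightarrow> real) \<Rightarrow> 'a set \<Rightarrow> 'a \<Rightarrow> 'a set" where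
  "right_of x G q = {p \<in> G. x q < x p}"

definition order_convex :: "real set \<Rightarrow> bool" where
  "order_convex J \<longleftrightarrow> (\<forall>u\<in>J. \<forall>v\<in>J. {u..v} \<subseteq> J)"

lemma order_convexD: "order_convex J \<Longrightarrow> u \<in> J \<Longrightarrow> v \<in> J \<Longrightarrow> u \<le> z \<Longrightarrow> z \<le> v \<Longrightarrow> z \<in> J"
  unfolding order_convex_def by (meson atLeastAtMost_iff subsetD)

lemma order_convex_avoids:
  assumes "order_convex J" and "z \<notin> J"
  shows "J \<subseteq> {..<z} \<or> J \<subseteq> {z<..}"
proof (rule ccontr)
  assume "\<not> ?thesis"
  then obtain u v where "u \<in> J" "v \<in> J" "\<not> u < z" "\<not> z < v" by auto
  with assms show False using order_convexD[of J v u z] by force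
qed

text \<open>
  The number of ends of \<open>G\<close> that stick out of the interval \<open>J\<close>. The counting bounds below
  grow with this number. When \<open>G\<close> is split at a point of \<open>J\<close>, the cuts are distributed
  among the two sides, so that one induction treats gaps inside \<open>J\<close>, gaps that contain one end of
  \<open>J\<close>, and gaps that contain both.
\<close>
definition cuts :: "('a \<Rightarrow> real) \<Rightarrow> real set \<Rightarrow> 'a set \<Rightarrow> nat" where
  "cuts x J G = of_bool (\<exists>p\<in>G. \<forall>v\<in>J. x p < v) + of_bool (\<exists>p\<in>G. \<forall>v\<in>J. v < x p)"

lemma cuts_le_2: "cuts x J G \<le> 2"
  by (simp add: cuts_def)

lemma cuts_mono: "G \<subseteq> H \<Longrightarrow> cuts x J G \<le> cuts x J H"
  unfolding cuts_def by (intro add_mono) (auto simp: of_bool_def)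

lemma cuts_eq_0:
  assumes "order_convex J" and "cuts x J G = 0" and "p \<in> G"
  shows "x p \<in> J"
proof (rule ccontr)
  assume "x p \<notin> J"
  with order_convex_avoids[OF assms(1)] have "J \<subseteq> {..<x p} \<or> J \<subseteq> {x p<..}" by blast
  with assms(2,3) show False by (auto simp: cuts_def)
qed

lemma cuts_split:
  assumes "q \<in> G" and "x q \<in> J"
  shows "cuts x J G = cuts x J (left_of x G q) + cuts x J (right_of x G q)"
proof -
  have "(\<exists>p\<in>left_of x G q. \<forall>v\<in>J. x p < v) = (\<exists>p\<in>G. \<forall>v\<in>J. x p < v)"
    and "(\<exists>p\<in>right_of x G q. \<forall>v\<in>J. v < x p) = (\<exists>p\<in>G. \<forall>v\<in>J. v < x p)"
    and "\<not> (\<exists>p\<in>left_of x G q. \<forall>v\<in>J. v < x p)"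
    and "\<not> (\<exists>p\<in>right_of x G q. \<forall>v\<in>J. x p < v)"
    using assms by (fastforce simp: left_of_def right_of_def)+
  then show ?thesis by (simp add: cuts_def)
qed

section \<open>The selection process\<close>

text \<open>
  Positions \<open>x\<close> and insertion times \<open>t\<close> are kept apart from the plane, since the process is run
  twice, with opposite time orders.
\<close>
locale insertion_order =
  fixes x t :: "'a \<Rightarrow> real" and V :: "'a set" and m L :: nat
  assumes finite_V: "finite V"
    and inj_x: "inj_on x V"
    and inj_t: "inj_on t V"
    and m_lower: "5 * L + 1 \<le> m"
    and m_upper: "m \<le> 5 * L + 5"
begin

abbreviation "left \<equiv> left_of x"
abbreviation "right \<equiv> right_of x"

text \<open>
  With these sizes a run of \<open>win\<close> points remains in the middle of \<open>full\<close> points when \<open>L\<close> points are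
  removed on either side, three candidates do not fit into a gap that is not full, and a gap
  with two candidates takes as much room as two gaps of the least size \<open>L\<close> and a point between
  them.
\<close>
abbreviation "full \<equiv> 4 * L + 1"
abbreviation "win \<equiv> 2 * L + 1"

text \<open>
  The possible contents, at some moment, of a gap whose points, present and future, form \<open>G\<close>.
\<close>
definition initial :: "'a set \<Rightarrow> 'a set \<Rightarrow> bool" where
  "initial P G \<longleftrightarrow> P \<subseteq> G \<and> (\<forall>p\<in>P. \<forall>r\<in>G. t r \<le> t p \<longrightarrow> r \<in> P)"

definition hits :: "'a set \<Rightarrow> 'a set \<Rightarrow> bool" where
  "hits P Y \<longleftrightarrow>
     (\<forall>J. order_convex J \<longrightarrow> win \<le> card {p \<in> P. x p \<in> J} \<longrightarrow> (\<exists>y\<in>Y. x y \<in> J))"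

text \<open>
  The trace that minimality of the candidate set leaves: each candidate is the only one in some
  run of \<open>win\<close> points. Unlike \<open>hits\<close>, this is inherited by subsets, hence by those candidates that
  are selected in the end.
\<close>
definition sparse :: "'a set \<Rightarrow> 'a set \<Rightarrow> bool" where
  "sparse P Z \<longleftrightarrow>
     (\<forall>z\<in>Z. \<exists>J. order_convex J \<and> x z \<in> J \<and> win \<le> card {p \<in> P. x p \<in> J} \<and>
        (\<forall>z'\<in>Z. x z' \<in> J \<longrightarrow> z' = z))"

text \<open>
  \<open>selects P G X\<close> describes the possible outcomes \<open>X\<close> of the process in a gap with points \<open>G\<close>, of
  which those in \<open>P\<close> are present. The candidates do not appear: what the counting needs of them
  is that the points of \<open>P\<close> selected in the future are \<open>sparse\<close>, and \<open>arrive\<close> records this for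
  every moment before the gap is full.
\<close>
inductive selects :: "'a set \<Rightarrow> 'a set \<Rightarrow> 'a set \<Rightarrow> bool" where
  stop: "card G < m \<Longrightarrow> selects P G {}"
| arrive: "initial (insert p P) G \<Longrightarrow> sparse P (X \<inter> P) \<Longrightarrow> card P < full \<Longrightarrow>
    selects (insert p P) G X \<Longrightarrow> selects P G X"
| split: "initial P G \<Longrightarrow> card P = full \<Longrightarrow> m \<le> card G \<Longrightarrow> q \<in> P \<Longrightarrow>
    L \<le> card (left P q) \<Longrightarrow> L \<le> card (right P q) \<Longrightarrow>
    selects (left P q) (left G q) X1 \<Longrightarrow> selects (right P q) (right G q) X2 \<Longrightarrow>
    selects P G (insert q (X1 \<union> X2))"

lemma sparse_subset: "sparse P Y \<Longrightarrow> Z \<subseteq> Y \<Longrightarrow> sparse P Z"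
  unfolding sparse_def by (meson subsetD)

text \<open>
  A candidate without a run of its own can be dropped: any run that it meets is also met by
  another candidate.
\<close>
lemma hits_thin:
  assumes "finite Y" and "hits P Y"
  shows "\<exists>Z\<subseteq>Y. hits P Z \<and> sparse P Z"
  using assms
proof (induction Y rule: finite_psubset_induct)
  case (psubset Y)
  show ?case
  proof (cases "sparse P Y")
    case False
    then obtain z where z: "z \<in> Y" and crowded: "\<And>J. order_convex J \<Longrightarrow> x z \<in> J \<Longrightarrow>
        win \<le> card {p \<in> P. x p \<in> J} \<Longrightarrow> \<exists>z'\<in>Y. x z' \<in> J \<and> z' \<noteq> z"
      unfolding sparse_def by blast
    have "hits P (Y - {z})"
      unfolding hits_def
    proof (intro allI impI)
      fix J assume J: "order_convex J" "win \<le> card {p \<in> P. x p \<in> J}"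
      with psubset.prems obtain y where "y \<in> Y" "x y \<in> J"
        unfolding hits_def by blast
      then show "\<exists>y\<in>Y - {z}. x y \<in> J"
        using crowded J by (cases "y = z") auto
    qed
    moreover have "Y - {z} \<subset> Y" using z by blast
    ultimately show ?thesis using psubset.IH[of "Y - {z}"] by blast
  qed (use psubset.prems in blast)
qed

lemma hits_insert:
  assumes "hits P Y"
  shows "hits (insert p P) (insert p Y)"
  unfolding hits_def
proof (intro allI impI)
  fix J assume J: "order_convex J" "win \<le> card {r \<in> insert p P. x r \<in> J}"
  show "\<exists>y\<in>insert p Y. x y \<in> J"
  proof (cases "x p \<in> J")
    case False
    then have "{r \<in> insert p P. x r \<in> J} = {r \<in> P. x r \<in> J}" by auto
    with J assms show ?thesis unfolding hits_def by auto
  qed blast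
qed

lemma hits_left:
  assumes "hits P Y"
  shows "hits (left P q) (left Y q)"
  unfolding hits_def
proof (intro allI impI)
  fix J assume J: "order_convex J" "win \<le> card {p \<in> left P q. x p \<in> J}"
  have "{p \<in> left P q. x p \<in> J} = {p \<in> P. x p \<in> J \<inter> {..<x q}}"
    by (auto simp: left_of_def)
  moreover have "order_convex (J \<inter> {..<x q})"
    using J(1) by (force simp: order_convex_def)
  ultimately have "\<exists>y\<in>Y. x y \<in> J \<inter> {..<x q}"
    using J(2) assms unfolding hits_def by metis
  then show "\<exists>y\<in>left Y q. x y \<in> J" by (auto simp: left_of_def)
qed

lemma hits_right:
  assumes "hits P Y"
  shows "hits (right P q) (right Y q)"
  unfolding hits_def
proof (intro allI impI)
  fix J assume J: "order_convex J" "win \<le> card {p \<in> right P q. x p \<in> J}"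
  have "{p \<in> right P q. x p \<in> J} = {p \<in> P. x p \<in> J \<inter> {x q<..}}"
    by (auto simp: right_of_def)
  moreover have "order_convex (J \<inter> {x q<..})"
    using J(1) by (force simp: order_convex_def)
  ultimately have "\<exists>y\<in>Y. x y \<in> J \<inter> {x q<..}"
    using J(2) assms unfolding hits_def by metis
  then show "\<exists>y\<in>right Y q. x y \<in> J" by (auto simp: right_of_def)
qed

text \<open>
  Elements of rank below \<open>n\<close> have distinct ranks.
\<close>
lemma card_low_rank:
  fixes f :: "'b \<Rightarrow> real"
  assumes "finite D" and "inj_on f D"
  shows "card {p \<in> D. card {r \<in> D. f r < f p} < n} \<le> n"
proof -
  let ?rank = "\<lambda>p. card {r \<in> D. f r < f p}"
  have less: "?rank p < ?rank p'" if "p \<in> D" "f p < f p'" for p p'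
    using that assms(1) by (intro psubset_card_mono) (auto intro: less_trans)
  have "inj_on ?rank {p \<in> D. ?rank p < n}"
  proof (rule inj_onI)
    fix p p' assume "p \<in> {p \<in> D. ?rank p < n}" "p' \<in> {p \<in> D. ?rank p < n}" "?rank p = ?rank p'"
    then show "p = p'"
      using less[of p p'] less[of p' p] inj_onD[OF assms(2), of p p']
      by (metis (no_types, lifting) less_irrefl linorder_less_linear mem_Collect_eq)
  qed
  then have "card {p \<in> D. ?rank p < n} \<le> card {..<n}"
    by (intro card_inj_on_le) auto
  then show ?thesis by simp
qed

text \<open>
  The points of a full gap with at least \<open>L\<close> points on either side form a run of
  \<open>full - 2 * L = win\<close> points, and therefore contain a candidate.
\<close>
lemma hits_middle:
  assumes "P \<subseteq> V" and "card P = full" and "Y \<subseteq> P" and "hits P Y"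
  shows "\<exists>q\<in>Y. L \<le> card (left P q) \<and> L \<le> card (right P q)"
proof -
  have fin: "finite P" using assms(1) finite_V finite_subset by blast
  have inj: "inj_on x P" using assms(1) inj_x inj_on_subset by blast
  define J where "J = {v. L \<le> card {p \<in> P. x p < v} \<and> L \<le> card {p \<in> P. v < x p}}"
  have conv: "order_convex J"
    unfolding order_convex_def
  proof (intro ballI subsetI)
    fix u v z assume "u \<in> J" "v \<in> J" "z \<in> {u..v}"
    then have "card {p \<in> P. x p < u} \<le> card {p \<in> P. x p < z}"
      "card {p \<in> P. v < x p} \<le> card {p \<in> P. z < x p}"
      using fin by (auto intro!: card_mono)
    with \<open>u \<in> J\<close> \<open>v \<in> J\<close> show "z \<in> J" by (simp add: J_def)
  qed
  let ?A = "{p \<in> P. card {r \<in> P. x r < x p} < L}"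
  let ?B = "{p \<in> P. card {r \<in> P. - x r < - x p} < L}"
  have "card ?A \<le> L" "card ?B \<le> L"
    using card_low_rank[OF fin inj, of L] card_low_rank[OF fin, of "\<lambda>p. - x p" L] inj
    by (auto simp: inj_on_def)
  then have AB: "card (?A \<union> ?B) \<le> 2 * L"
    using card_Un_le[of ?A ?B] by linarith
  have "{p \<in> P. x p \<in> J} = P - (?A \<union> ?B)"
    by (auto simp: J_def not_less)
  moreover have "card (P - (?A \<union> ?B)) = card P - card (?A \<union> ?B)"
    using fin by (intro card_Diff_subset) auto
  ultimately have "card {p \<in> P. x p \<in> J} = card P - card (?A \<union> ?B)" by metis
  then have "win \<le> card {p \<in> P. x p \<in> J}"
    using AB assms(2) by linarith
  then obtain q where "q \<in> Y" "x q \<in> J"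
    using assms(4) conv unfolding hits_def by blast
  then show ?thesis by (auto simp: J_def left_of_def right_of_def)
qed

lemma left_subset: "left G q \<subseteq> G" and right_subset: "right G q \<subseteq> G"
  by (auto simp: left_of_def right_of_def)

lemma initial_left: "initial P G \<Longrightarrow> initial (left P q) (left G q)"
  and initial_right: "initial P G \<Longrightarrow> initial (right P q) (right G q)"
  by (auto simp: initial_def left_of_def right_of_def)

lemma selects_subset: "selects P G X \<Longrightarrow> X \<subseteq> G"
  by (induction rule: selects.induct) (auto simp: initial_def left_of_def right_of_def)

text \<open>
  The process never gets stuck, with \<open>Y\<close> as the current stock of candidates. The conclusion
  \<open>X \<inter> P \<subseteq> Y\<close> says that present points that are no candidates are never selected; as the new
  candidate on an arrival is the arriving point, thinning makes this intersection sparse.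
\<close>
lemma selects_exists:
  assumes "G \<subseteq> V" and "initial P G" and "card P \<le> full" and "Y \<subseteq> P" and "hits P Y"
  shows "\<exists>X. selects P G X \<and> X \<inter> P \<subseteq> Y"
  using assms
proof (induction "card G + card (G - P)" arbitrary: G P Y rule: less_induct)
  case less
  have finG: "finite G" using less.prems(1) finite_V finite_subset by blast
  have PG: "P \<subseteq> G" using less.prems(2) by (simp add: initial_def)
  have finY: "finite Y" using less.prems(4) PG finG by (meson finite_subset)
  consider "card G < m" | "m \<le> card G" "card P < full" | "m \<le> card G" "card P = full"
    using less.prems(3) by linarith
  then show ?case
  proof cases
    case 1
    then show ?thesis using selects.stop by blast
  next
    case 2
    obtain Z where Z: "Z \<subseteq> Y" "hits P Z" "sparse P Z"
      using hits_thin[OF finY less.prems(5)] by blast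
    have "G - P \<noteq> {}"
    proof
      assume "G - P = {}"
      then have "G = P" using PG by blast
      then show False using 2 m_lower by simp
    qed
    moreover have "finite (G - P)" using finG by simp
    ultimately obtain p where p: "p \<in> G - P" and first: "\<And>r. r \<in> G - P \<Longrightarrow> t p \<le> t r"
      using ex_min_if_finite[of "t ` (G - P)"] by (force simp: not_less)
    have init: "initial (insert p P) G"
      unfolding initial_def
    proof (intro conjI ballI impI)
      show "insert p P \<subseteq> G" using p PG by blast
      fix s r assume s: "s \<in> insert p P" and r: "r \<in> G" "t r \<le> t s"
      show "r \<in> insert p P"
      proof (cases "s = p")
        case True
        then have "r \<notin> P \<Longrightarrow> t r = t p" using first r by force
        then show ?thesis using inj_t p r less.prems(1) by (auto dest: inj_onD)
      next
        case False
        then show ?thesis using s r less.prems(2) by (auto simp: initial_def)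
      qed
    qed
    have "card (G - insert p P) < card (G - P)"
      using p finG by (intro psubset_card_mono) auto
    moreover have "card (insert p P) \<le> full"
      using 2(2) card_insert_le_m1[of full P p] by simp
    moreover have "insert p Z \<subseteq> insert p P" using Z(1) less.prems(4) by blast
    ultimately obtain X where X: "selects (insert p P) G X" "X \<inter> insert p P \<subseteq> insert p Z"
      using less.hyps[of G "insert p P" "insert p Z"] less.prems(1) init hits_insert[OF Z(2)]
      by auto
    then have XP: "X \<inter> P \<subseteq> Z" using p by blast
    have "selects P G X"
      using init sparse_subset[OF Z(3) XP] 2(2) X(1) by (rule selects.arrive)
    then show ?thesis using XP Z(1) by blast
  next
    case 3
    obtain q where q: "q \<in> Y" "L \<le> card (left P q)" "L \<le> card (right P q)"
      using hits_middle[OF _ 3(2) less.prems(4,5)] PG less.prems(1) by blast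
    have qP: "q \<in> P" and qG: "q \<in> G" using q(1) less.prems(4) PG by auto
    have smaller: "card (side G) + card (side G - side P) < card G + card (G - P)"
      if "side G \<subseteq> G - {q}" "side G - side P \<subseteq> G - P" for side :: "'a set \<Rightarrow> 'a set"
    proof -
      have "card (side G) \<le> card (G - {q})" "card (side G - side P) \<le> card (G - P)"
        using that finG by (auto intro!: card_mono)
      moreover have "card (G - {q}) < card G" using qG finG by (rule card_Diff1_less[rotated])
      ultimately show ?thesis by linarith
    qed
    have fin_P: "finite P" using PG finG finite_subset by blast
    have cards: "card (left P q) \<le> full" "card (right P q) \<le> full"
      using card_mono[OF fin_P left_subset] card_mono[OF fin_P right_subset] 3(2) by metis+
    have "\<exists>X. selects (left P q) (left G q) X \<and> X \<inter> left P q \<subseteq> left Y q"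
    proof (rule less.hyps)
      show "card (left G q) + card (left G q - left P q) < card G + card (G - P)"
        by (rule smaller[of "\<lambda>A. left A q"]) (auto simp: left_of_def)
      show "left Y q \<subseteq> left P q" using less.prems(4) by (auto simp: left_of_def)
    qed (use less.prems cards(1) left_subset[of G q] in
        \<open>auto intro: initial_left hits_left\<close>)
    then obtain X1 where X1: "selects (left P q) (left G q) X1" "X1 \<inter> left P q \<subseteq> left Y q"
      by blast
    have "\<exists>X. selects (right P q) (right G q) X \<and> X \<inter> right P q \<subseteq> right Y q"
    proof (rule less.hyps)
      show "card (right G q) + card (right G q - right P q) < card G + card (G - P)"
        by (rule smaller[of "\<lambda>A. right A q"]) (auto simp: right_of_def)
      show "right Y q \<subseteq> right P q" using less.prems(4) by (auto simp: right_of_def)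
    qed (use less.prems cards(2) right_subset[of G q] in
        \<open>auto intro: initial_right hits_right\<close>)
    then obtain X2 where X2: "selects (right P q) (right G q) X2" "X2 \<inter> right P q \<subseteq> right Y q"
      by blast
    have sel: "selects P G (insert q (X1 \<union> X2))"
      using less.prems(2) 3(2,1) qP q(2,3) X1(1) X2(1) by (rule selects.split)
    have "X1 \<subseteq> left G q" "X2 \<subseteq> right G q"
      using X1(1) X2(1) selects_subset by blast+
    then have "X1 \<inter> P \<subseteq> X1 \<inter> left P q" "X2 \<inter> P \<subseteq> X2 \<inter> right P q"
      by (auto simp: left_of_def right_of_def)
    then have "insert q (X1 \<union> X2) \<inter> P \<subseteq> Y"
      using q(1) X1(2) X2(2) left_subset[of Y q] right_subset[of Y q] by blast
    with sel show ?thesis by blast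
  qed
qed

section \<open>Counting across a split\<close>

lemma card_split:
  assumes "A \<subseteq> V" and "q \<in> A"
  shows "card {p \<in> A. Q p} =
    card {p \<in> left A q. Q p} + card {p \<in> right A q. Q p} + of_bool (Q q)"
proof -
  have fin: "finite A" using assms(1) finite_V finite_subset by blast
  have trichotomy: "p = q \<or> x p < x q \<or> x q < x p" if "p \<in> A" for p
    using that assms inj_x by (metis inj_onD linorder_less_linear subsetD)
  have "{p \<in> A. Q p} =
      ({p \<in> left A q. Q p} \<union> {p \<in> right A q. Q p}) \<union> (if Q q then {q} else {})"
    using trichotomy assms(2) by (auto simp: left_of_def right_of_def)
  moreover have "card (({p \<in> left A q. Q p} \<union> {p \<in> right A q. Q p}) \<union> (if Q q then {q} else {})) =
      card ({p \<in> left A q. Q p} \<union> {p \<in> right A q. Q p}) + card (if Q q then {q} else {})"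
    using fin by (intro card_Un_disjoint) (auto simp: left_of_def right_of_def)
  moreover have "card ({p \<in> left A q. Q p} \<union> {p \<in> right A q. Q p}) =
      card {p \<in> left A q. Q p} + card {p \<in> right A q. Q p}"
    using fin by (intro card_Un_disjoint) (auto simp: left_of_def right_of_def)
  ultimately show ?thesis by simp
qed

lemma parts_of_split:
  assumes "X1 \<subseteq> left G q" and "X2 \<subseteq> right G q"
  shows "left (insert q (X1 \<union> X2)) q = X1" and "right (insert q (X1 \<union> X2)) q = X2"
  using assms by (auto simp: left_of_def right_of_def)

lemma selects_split_cards:
  assumes "selects (left P q) (left G q) X1" and "selects (right P q) (right G q) X2"
    and "q \<in> G" and "G \<subseteq> V"
  shows "card {p \<in> insert q (X1 \<union> X2). Q p} =
    card {p \<in> X1. Q p} + card {p \<in> X2. Q p} + of_bool (Q q)"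
proof -
  have sub: "X1 \<subseteq> left G q" "X2 \<subseteq> right G q"
    using assms(1,2) selects_subset by blast+
  then have "insert q (X1 \<union> X2) \<subseteq> V"
    using assms(3,4) left_subset[of G q] right_subset[of G q] by blast
  from card_split[OF this, of q Q] show ?thesis
    by (simp only: parts_of_split[OF sub] insertI1 simp_thms)
qed

lemma sides_large:
  assumes "initial P G" and "G \<subseteq> V" and "L \<le> card (left P q)" and "L \<le> card (right P q)"
  shows "L \<le> card (left G q)" and "L \<le> card (right G q)"
proof -
  have "finite G" using assms(2) finite_V finite_subset by blast
  moreover have "left P q \<subseteq> left G q" "right P q \<subseteq> right G q"
    using assms(1) by (auto simp: initial_def left_of_def right_of_def)
  moreover have "finite (left G q)" "finite (right G q)"
    using \<open>finite G\<close> left_subset right_subset by (meson finite_subset)+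
  ultimately show "L \<le> card (left G q)" "L \<le> card (right G q)"
    using assms(3,4) card_mono by (meson le_trans)+
qed

section \<open>Every early edge is hit\<close>

text \<open>
  A gap that contains the edge has at least \<open>m\<close> points, so it is split. The selected point \<open>q\<close> is
  in the edge, or the edge lies on one side of \<open>q\<close>, or \<open>q\<close> lies in \<open>J\<close> but is too late for the
  edge. The last case is impossible, since the edge would then have fewer than \<open>full \<le> m\<close> points.
\<close>
lemma selects_hit:
  assumes "selects P G X" and "G \<subseteq> V" and "order_convex J"
    and "card {p \<in> G. x p \<in> J \<and> t p \<le> c} = m"
  shows "\<exists>p\<in>X. x p \<in> J \<and> t p \<le> c"
  using assms
proof (induction rule: selects.induct)
  case (stop G P)
  have "finite G" using stop.prems(1) finite_V finite_subset by blast
  then have "card {p \<in> G. x p \<in> J \<and> t p \<le> c} \<le> card G" by (intro card_mono) auto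
  then show ?case using stop by linarith
next
  case (split P G q X1 X2)
  have qG: "q \<in> G" using split.hyps(1,4) by (auto simp: initial_def)
  have finP: "finite P" using split.hyps(1) split.prems(1) finite_V
    by (meson finite_subset initial_def)
  have sides: "left G q \<subseteq> V" "right G q \<subseteq> V"
    using split.prems(1) left_subset right_subset by blast+
  note cards = card_split[OF split.prems(1) qG, of "\<lambda>p. x p \<in> J \<and> t p \<le> c"]
  consider "x q \<in> J" "t q \<le> c" | "x q \<in> J" "c < t q" | "x q \<notin> J" by linarith
  then show ?case
  proof cases
    case 2
    have "{p \<in> G. x p \<in> J \<and> t p \<le> c} \<subseteq> P - {q}"
      using 2 split.hyps(1,4) by (force simp: initial_def)
    then have "m \<le> card (P - {q})"
      using card_mono[of "P - {q}"] split.prems(3) finP by fastforce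
    then show ?thesis using split.hyps(2,4) finP m_lower by simp
  next
    case 3
    then consider "J \<subseteq> {..<x q}" | "J \<subseteq> {x q<..}"
      using order_convex_avoids[OF split.prems(2)] by blast
    then show ?thesis
    proof cases
      case 1
      then have none: "{p \<in> right G q. x p \<in> J \<and> t p \<le> c} = {}" by (force simp: right_of_def)
      have "card {p \<in> left G q. x p \<in> J \<and> t p \<le> c} = m"
        using cards split.prems(3) 3 unfolding none by simp
      then show ?thesis using split.IH(1) split.prems(2) sides by blast
    next
      case 2
      then have none: "{p \<in> left G q. x p \<in> J \<and> t p \<le> c} = {}" by (force simp: left_of_def)
      have "card {p \<in> right G q. x p \<in> J \<and> t p \<le> c} = m"
        using cards split.prems(3) 3 unfolding none by simp
      then show ?thesis using split.IH(2) split.prems(2) sides by blast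
    qed
  qed auto
qed simp

section \<open>Selected points in late edges\<close>

text \<open>
  The first selected point of a gap is backed by \<open>m\<close> points because gaps that stay smaller do not
  split. Each further one is backed by \<open>L + 1\<close> points, itself and those of a side that is split
  off: this side has at least \<open>L\<close> points, and even \<open>m\<close> if something is selected in it.
\<close>
lemma selects_gap_card:
  assumes "selects P G X" and "G \<subseteq> V" and "X \<noteq> {}"
  shows "m + card X * (L + 1) \<le> card G + (L + 1)"
  using assms
proof (induction rule: selects.induct)
  case (split P G q X1 X2)
  have qG: "q \<in> G" using split.hyps(1,4) by (auto simp: initial_def)
  have sides: "left G q \<subseteq> V" "right G q \<subseteq> V"
    using split.prems(1) left_subset right_subset by blast+
  have G: "card G = card (left G q) + card (right G q) + 1"
    using card_split[OF split.prems(1) qG, of "\<lambda>_. True"] by simp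
  have X: "card (insert q (X1 \<union> X2)) = card X1 + card X2 + 1"
    using selects_split_cards[OF split.hyps(7,8) qG split.prems(1), of "\<lambda>_. True"]
    by (simp only: simp_thms Collect_mem_eq of_bool_eq)
  have large: "L \<le> card (left G q)" "L \<le> card (right G q)"
    using sides_large[OF split.hyps(1) split.prems(1) split.hyps(5,6)] by blast+
  have 1: "X1 = {} \<or> m + card X1 * (L + 1) \<le> card (left G q) + (L + 1)"
    and 2: "X2 = {} \<or> m + card X2 * (L + 1) \<le> card (right G q) + (L + 1)"
    using split.IH sides by blast+
  show ?case
    unfolding X using 1 2 G large split.hyps(3) m_lower by (auto simp: algebra_simps)
qed auto

text \<open>
  At the end of time, \<open>L + 1\<close> points of \<open>J\<close> back each selected point of \<open>J\<close>: a split in \<open>J\<close> creates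
  a new side with at least \<open>L\<close> points. The sides that finally contain an end of \<open>J\<close> may have
  their \<open>L\<close> points outside \<open>J\<close>, whence the correction by \<open>cuts\<close>.
\<close>
lemma selects_interval_card:
  assumes "selects P G X" and "G \<subseteq> V" and "order_convex J" and "L \<le> card G"
  shows "card {p \<in> X. x p \<in> J} * (L + 1) + L \<le> card {p \<in> G. x p \<in> J} + cuts x J G * L"
  using assms
proof (induction rule: selects.induct)
  case (stop G P)
  show ?case
  proof (cases "cuts x J G = 0")
    case True
    then have "{p \<in> G. x p \<in> J} = G"
      using cuts_eq_0[OF stop.prems(2) True] by auto
    then show ?thesis using stop.prems(3) by simp
  qed (simp add: trans_le_add2)
next
  case (split P G q X1 X2)
  have qG: "q \<in> G" using split.hyps(1,4) by (auto simp: initial_def)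
  have sides: "left G q \<subseteq> V" "right G q \<subseteq> V"
    using split.prems(1) left_subset right_subset by blast+
  note G = card_split[OF split.prems(1) qG, of "\<lambda>p. x p \<in> J"]
  note X = selects_split_cards[OF split.hyps(7,8) qG split.prems(1), of "\<lambda>p. x p \<in> J"]
  have large: "L \<le> card (left G q)" "L \<le> card (right G q)"
    using sides_large[OF split.hyps(1) split.prems(1) split.hyps(5,6)] by blast+
  note IH1 = split.IH(1)[OF sides(1) split.prems(2) large(1)]
  note IH2 = split.IH(2)[OF sides(2) split.prems(2) large(2)]
  have X12: "X1 \<subseteq> left G q" "X2 \<subseteq> right G q"
    using split.hyps(7,8) selects_subset by blast+
  show ?case
  proof (cases "x q \<in> J")
    case True
    show ?thesis
      using IH1 IH2 True cuts_split[of q G x J, OF qG True]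
      unfolding X G by (simp add: algebra_simps)
  next
    case False
    then consider "J \<subseteq> {..<x q}" | "J \<subseteq> {x q<..}"
      using order_convex_avoids[OF split.prems(2)] by blast
    then show ?thesis
    proof cases
      case 1
      then have none: "{p \<in> X2. x p \<in> J} = {}" using X12(2) by (force simp: right_of_def)
      have fewer: "cuts x J (left G q) * L \<le> cuts x J G * L"
        using cuts_mono[OF left_subset] by (intro mult_le_mono1)
      show ?thesis
        using IH1 fewer unfolding X G none
          by (simp only: card.empty False simp_thms of_bool_eq add_0_left add_0_right)
    next
      case 2
      then have none: "{p \<in> X1. x p \<in> J} = {}" using X12(1) by (force simp: left_of_def)
      have fewer: "cuts x J (right G q) * L \<le> cuts x J G * L"
        using cuts_mono[OF right_subset] by (intro mult_le_mono1)
      show ?thesis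
        using IH2 fewer unfolding X G none
          by (simp only: card.empty False simp_thms of_bool_eq add_0_left add_0_right)
    qed
  qed
qed simp

text \<open>
  Now only the points inserted from time \<open>c\<close> on may pay. If the gap fills up before \<open>c\<close>, the two
  sides are treated separately. Otherwise at most \<open>4 * L\<close> of its points are earlier than \<open>c\<close>. For
  a gap inside \<open>J\<close> this loss is covered by the \<open>m \<ge> 5 * L + 1\<close> points of \<open>selects_gap_card\<close>; for a
  gap cut by an end of \<open>J\<close> it is the extra \<open>4 * L\<close> in the bound.
\<close>
lemma selects_late_card:
  assumes "selects P G X" and "G \<subseteq> V" and "order_convex J" and "L \<le> card G"
  shows "card {p \<in> X. x p \<in> J \<and> c \<le> t p} * (L + 1)
    \<le> card {p \<in> G. x p \<in> J \<and> c \<le> t p} + cuts x J G * (4 * L)"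
  using assms
proof (induction rule: selects.induct)
  case (split P G q X1 X2)
  let ?X = "insert q (X1 \<union> X2)"
  have qG: "q \<in> G" and PG: "P \<subseteq> G" using split.hyps(1,4) by (auto simp: initial_def)
  have finG: "finite G" using split.prems(1) finite_V finite_subset by blast
  have finP: "finite P" using PG finG finite_subset by blast
  have sides: "left G q \<subseteq> V" "right G q \<subseteq> V"
    using split.prems(1) left_subset right_subset by blast+
  have sel: "selects P G ?X" by (rule selects.split[OF split.hyps])
  have XG: "?X \<subseteq> G" using selects_subset[OF sel] .
  have finX: "finite ?X" by (rule finite_subset[OF XG finG])
  show ?case
  proof (cases "\<exists>d\<in>P. c \<le> t d")
    case True
    then obtain d where d: "d \<in> P" "c \<le> t d" by blast
    have "{p \<in> G. t p < c} \<subseteq> P - {d}"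
      using d split.hyps(1) by (force simp: initial_def)
    then have "card {p \<in> G. t p < c} \<le> card (P - {d})"
      using finP by (intro card_mono) auto
    then have early: "card {p \<in> G. t p < c} \<le> 4 * L"
      using split.hyps(2) d(1) finP by simp
    have late: "card {p \<in> ?X. x p \<in> J \<and> c \<le> t p} \<le> card {p \<in> ?X. x p \<in> J}"
      using finX by (intro card_mono) auto
    show ?thesis
    proof (cases "cuts x J G = 0")
      case whole: True
      have inJ: "\<And>p. p \<in> G \<Longrightarrow> x p \<in> J"
        using cuts_eq_0[OF split.prems(2) whole] .
      have "card G = card {p \<in> G. t p < c} + card {p \<in> G. c \<le> t p}"
        using finG by (subst card_Un_disjoint[symmetric]) (auto intro: arg_cong[where f = card])
      moreover have "card {p \<in> G. x p \<in> J \<and> c \<le> t p} = card {p \<in> G. c \<le> t p}"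
        using inJ by (intro arg_cong[where f = card]) auto
      moreover have "m + card ?X * (L + 1) \<le> card G + (L + 1)"
        by (rule selects_gap_card[OF sel split.prems(1)]) simp
      moreover have "card {p \<in> ?X. x p \<in> J \<and> c \<le> t p} * (L + 1) \<le> card ?X * (L + 1)"
        using finX by (intro mult_le_mono1 card_mono) auto
      ultimately show ?thesis using early m_lower by linarith
    next
      case False
      then obtain k where k: "cuts x J G = Suc k" by (cases "cuts x J G") auto
      have "card {p \<in> G. x p \<in> J}
          \<le> card ({p \<in> G. x p \<in> J \<and> c \<le> t p} \<union> {p \<in> G. t p < c})"
        using finG by (intro card_mono) auto
      also have "\<dots> \<le> card {p \<in> G. x p \<in> J \<and> c \<le> t p} + card {p \<in> G. t p < c}"
        by (rule card_Un_le)
      finally have "card {p \<in> G. x p \<in> J} \<le> card {p \<in> G. x p \<in> J \<and> c \<le> t p} + 4 * L"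
        using early by linarith
      moreover have "card {p \<in> ?X. x p \<in> J} * (L + 1) + L
          \<le> card {p \<in> G. x p \<in> J} + Suc k * L"
        using selects_interval_card[OF sel split.prems] k by simp
      moreover have "card {p \<in> ?X. x p \<in> J \<and> c \<le> t p} * (L + 1)
          \<le> card {p \<in> ?X. x p \<in> J} * (L + 1)"
        using late by (intro mult_le_mono1)
      moreover have "k * L \<le> k * (4 * L)" by simp
      ultimately show ?thesis unfolding k by simp
    qed
  next
    case False
    then have q_early: "\<not> c \<le> t q" using split.hyps(4) by blast
    note G = card_split[OF split.prems(1) qG, of "\<lambda>p. x p \<in> J \<and> c \<le> t p"]
    note X = selects_split_cards[OF split.hyps(7,8) qG split.prems(1),
        of "\<lambda>p. x p \<in> J \<and> c \<le> t p"]
    have large: "L \<le> card (left G q)" "L \<le> card (right G q)"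
      using sides_large[OF split.hyps(1) split.prems(1) split.hyps(5,6)] by blast+
    note IH1 = split.IH(1)[OF sides(1) split.prems(2) large(1)]
    note IH2 = split.IH(2)[OF sides(2) split.prems(2) large(2)]
    have X12: "X1 \<subseteq> left G q" "X2 \<subseteq> right G q"
      using split.hyps(7,8) selects_subset by blast+
    show ?thesis
    proof (cases "x q \<in> J")
      case True
      show ?thesis
        using IH1 IH2 q_early cuts_split[of q G x J, OF qG True]
        unfolding X G by (simp add: algebra_simps)
    next
      case False
      then consider "J \<subseteq> {..<x q}" | "J \<subseteq> {x q<..}"
        using order_convex_avoids[OF split.prems(2)] by blast
      then show ?thesis
      proof cases
        case 1
        then have none: "{p \<in> X2. x p \<in> J \<and> c \<le> t p} = {}" using X12(2) by (force simp: right_of_def)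
        have fewer: "cuts x J (left G q) * (4 * L) \<le> cuts x J G * (4 * L)"
          using cuts_mono[OF left_subset] by (intro mult_le_mono1)
        show ?thesis
          using IH1 fewer unfolding X G none
            by (simp only: card.empty False simp_thms of_bool_eq add_0_left add_0_right)
      next
        case 2
        then have none: "{p \<in> X1. x p \<in> J \<and> c \<le> t p} = {}" using X12(1) by (force simp: left_of_def)
        have fewer: "cuts x J (right G q) * (4 * L) \<le> cuts x J G * (4 * L)"
          using cuts_mono[OF right_subset] by (intro mult_le_mono1)
        show ?thesis
          using IH2 fewer unfolding X G none
            by (simp only: card.empty False simp_thms of_bool_eq add_0_left add_0_right)
      qed
    qed
  qed
qed auto

section \<open>Selected points in early edges\<close>

text \<open>
  The private run of one of two candidates stays on its own side of the other one.
\<close>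
lemma sparse_side_cards:
  assumes "sparse P Z" and "finite P" and "y \<in> Z" and "z \<in> Z" and "x y < x z"
  shows "win \<le> card (left P z)" and "win \<le> card (right P y)"
proof -
  obtain J where J: "order_convex J" "x y \<in> J" "win \<le> card {p \<in> P. x p \<in> J}" "x z \<notin> J"
    using assms(1,3,4,5) unfolding sparse_def by (metis less_irrefl)
  then have "J \<subseteq> {..<x z}" using order_convex_avoids[of J "x z"] assms(5) by force
  then have "card {p \<in> P. x p \<in> J} \<le> card (left P z)"
    using assms(2) by (intro card_mono) (auto simp: left_of_def)
  with J(3) show "win \<le> card (left P z)" by linarith
next
  obtain J where J: "order_convex J" "x z \<in> J" "win \<le> card {p \<in> P. x p \<in> J}" "x y \<notin> J"
    using assms(1,3,4,5) unfolding sparse_def by (metis less_irrefl)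
  then have "J \<subseteq> {x y<..}" using order_convex_avoids[of J "x y"] assms(5) by force
  then have "card {p \<in> P. x p \<in> J} \<le> card (right P y)"
    using assms(2) by (intro card_mono) (auto simp: right_of_def)
  with J(3) show "win \<le> card (right P y)" by linarith
qed

text \<open>
  The middle one of three candidates would have \<open>win\<close> points on either side, more than fit into a
  gap that is not full.
\<close>
lemma sparse_card_le_2:
  assumes "sparse P Z" and "P \<subseteq> V" and "Z \<subseteq> P" and "card P < full"
  shows "card Z \<le> 2"
proof (rule ccontr)
  assume "\<not> card Z \<le> 2"
  then have "3 \<le> card Z" by simp
  then obtain T where T: "T \<subseteq> Z" "card T = 3" by (meson obtain_subset_with_card_n)
  then obtain a b c where abc: "{a, b, c} \<subseteq> Z" "a \<noteq> b" "b \<noteq> c" "a \<noteq> c"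
    by (auto simp: card_3_iff)
  then have "x a \<noteq> x b" "x b \<noteq> x c" "x a \<noteq> x c"
    using inj_onD[OF inj_x] assms(2,3) by (meson insert_subset subsetD)+
  then obtain z1 z2 z3 where z: "{z1, z2, z3} \<subseteq> Z" "x z1 < x z2" "x z2 < x z3"
    using abc(1) by (metis insert_commute linorder_neqE_linordered_idom)
  have fin: "finite P" using assms(2) finite_V finite_subset by blast
  have "win \<le> card (left P z2)" "win \<le> card (right P z2)"
    using sparse_side_cards[OF assms(1) fin] z by auto
  moreover have "card P = card (left P z2) + card (right P z2) + 1"
    using card_split[OF assms(2), of z2 "\<lambda>_. True"] z(1) assms(3) by auto
  ultimately show False using assms(4) by linarith
qed

text \<open>
  Twice the permitted number of selected points, plus two, among \<open>n\<close> early points of a gap with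
  \<open>c\<close> cuts. To see where it comes from, take a gap inside \<open>J\<close> in which \<open>a\<close> of the current gaps
  carry two candidates and \<open>b\<close> carry none. There are \<open>a + b - 1\<close> selected points between these
  gaps, so \<open>a + b - 1 + 2 * a\<close> points count, whereas \<open>n + 1 \<ge> (2 * a + b) * (L + 1)\<close>, because
  current gaps have at least \<open>L\<close> points and those with two candidates at least \<open>2 * L + 1\<close>. The
  quotient is therefore at least \<open>2 * a + b\<close>, and \<open>2 * (3 * a + b) \<le> 3 * (2 * a + b)\<close>. A cut gap
  can show one candidate in \<open>J\<close> at the cost of a single point; the term \<open>4 * c\<close> accounts for this.
\<close>
definition early_bound :: "nat \<Rightarrow> nat \<Rightarrow> int" where
  "early_bound n c = 3 * ((int n + 1 - int c) div (int L + 1)) + 4 * int c"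

text \<open>
  An additional cut lowers the quotient by at most one, hence three times the quotient by less
  than the four that are gained.
\<close>
lemma early_bound_mono:
  assumes "c \<le> d"
  shows "early_bound n c \<le> early_bound n d"
proof -
  let ?z = "int n + 1 - int c" and ?k = "int d - int c"
  have "- ?k + ?z div (int L + 1) = (?z + - ?k * (int L + 1)) div (int L + 1)"
    by (rule div_mult_self1[symmetric]) simp
  also have "\<dots> \<le> (?z - ?k) div (int L + 1)"
  proof (rule zdiv_mono1)
    have "?k * 1 \<le> ?k * (int L + 1)" using assms by (intro mult_left_mono) auto
    then show "?z + - ?k * (int L + 1) \<le> ?z - ?k" by (simp only: mult_minus_left mult_1_right)
  qed simp
  also have "?z - ?k = int n + 1 - int d" by simp
  finally show ?thesis using assms unfolding early_bound_def by linarith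
qed

lemma early_bound_add: "early_bound n c + early_bound k d \<le> early_bound (n + k + 1) (c + d)"
proof -
  let ?a = "int n + 1 - int c" and ?b = "int k + 1 - int d" and ?u = "int L + 1"
  have "?a div ?u + ?b div ?u \<le> (?a + ?b) div ?u"
    by (subst div_add1_eq[of ?a ?b ?u]) (simp add: pos_imp_zdiv_nonneg_iff)
  moreover have "?a + ?b = int (n + k + 1) + 1 - int (c + d)" by simp
  ultimately show ?thesis by (simp add: early_bound_def)
qed

lemma early_bound_ge:
  assumes "int k * (int L + 1) \<le> int n + 1 - int c"
  shows "3 * int k + 4 * int c \<le> early_bound n c"
  using assms zdiv_mono1[OF assms, of "int L + 1"] by (simp add: early_bound_def)

lemma early_bound_ge_2:
  assumes "c \<le> 2" and "c = 0 \<Longrightarrow> L \<le> n"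
  shows "2 \<le> early_bound n c"
proof (cases "c = 0")
  case True
  then show ?thesis using early_bound_ge[of 1 n c] assms by simp
next
  case False
  have "early_bound n 1 \<ge> 4" using early_bound_ge[of 0 n 1] by simp
  then show ?thesis using early_bound_mono[of 1 c n] False by simp
qed

lemma early_bound_edge:
  assumes "c \<le> 2"
  shows "early_bound m c \<le> 20"
proof -
  have "(int m - 1) div (int L + 1) < 5"
  proof -
    have "(int m - 1) div (int L + 1) \<le> (- 1 + 5 * (int L + 1)) div (int L + 1)"
      using m_upper by (intro zdiv_mono1) auto
    also have "\<dots> = 5 + - 1 div (int L + 1)"
      by (rule div_mult_self1) simp
    also have "\<dots> < 5" by (simp add: div_eq_minus1)
    finally show ?thesis .
  qed
  then have "early_bound m 2 \<le> 20" by (simp add: early_bound_def)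
  then show ?thesis using early_bound_mono[OF assms, of m] by linarith
qed

text \<open>
  The early bound in a gap \<open>A\<close> that is not full yet, where the points selected later form a
  sparse set. The delicate case is that of two candidates in an interval which cuts the gap at
  one end only: the private run of the candidate nearer to the uncut end lies between that end
  and the other candidate, and therefore inside \<open>J\<close>.
\<close>
lemma sparse_interval_card:
  assumes "sparse A Z" and "A \<subseteq> V" and "Z \<subseteq> A" and "card A < full" and "L \<le> card A"
    and "order_convex J"
  shows "2 * int (card {p \<in> Z. x p \<in> J}) + 2 \<le> early_bound (card {p \<in> A. x p \<in> J}) (cuts x J A)"
proof -
  define Y where "Y = {p \<in> Z. x p \<in> J}"
  define n where "n = card {p \<in> A. x p \<in> J}"
  define c where "c = cuts x J A"
  have fin: "finite A" using assms(2) finite_V finite_subset by blast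
  have YA: "Y \<subseteq> {p \<in> A. x p \<in> J}" using assms(3) by (auto simp: Y_def)
  have finY: "finite Y" using YA fin finite_subset by fastforce
  have "sparse A Y" using assms(1) by (rule sparse_subset) (auto simp: Y_def)
  then have Y2: "card Y \<le> 2" using sparse_card_le_2 assms(2,4) YA by blast
  have Yn: "card Y \<le> n" unfolding n_def using YA fin by (intro card_mono) auto
  have whole: "n = card A" if "c = 0"
  proof -
    have "{p \<in> A. x p \<in> J} = A" using cuts_eq_0[OF assms(6)] that by (auto simp: c_def)
    then show ?thesis by (simp add: n_def)
  qed
  have "c \<le> 2" by (simp add: c_def cuts_le_2)
  then consider "card Y = 0" | "card Y > 0" "c = 0" | "card Y = 1" "c = 1"
    | "card Y = 2" "c = 1" | "card Y > 0" "c = 2"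
    using Y2 by linarith
  then have "2 * int (card Y) + 2 \<le> early_bound n c"
  proof cases
    case 1
    then show ?thesis using early_bound_ge_2[OF \<open>c \<le> 2\<close>, of n] whole assms(5) by simp
  next
    case 2
    then obtain z where "z \<in> Y" by (auto simp: card_gt_0_iff)
    then obtain I where I: "win \<le> card {p \<in> A. x p \<in> I}"
      using \<open>sparse A Y\<close> unfolding sparse_def by blast
    also have "\<dots> \<le> card A" using fin by (intro card_mono) auto
    finally have "win \<le> n" using whole 2 by simp
    then show ?thesis using early_bound_ge[of 2 n c] 2 Y2 by simp
  next
    case 3
    then show ?thesis using early_bound_ge[of 0 n c] by simp
  next
    case 4
    then obtain a b where ab: "Y = {a, b}" "a \<noteq> b" by (auto simp: card_2_iff)
    then have "x a \<noteq> x b" using inj_onD[OF inj_x, of a b] YA assms(2) by blast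
    then obtain y z where yz: "y \<in> Y" "z \<in> Y" "x y < x z"
      using ab by (metis insertCI linorder_neqE_linordered_idom)
    note large = sparse_side_cards[OF \<open>sparse A Y\<close> fin yz]
    have J: "x y \<in> J" "x z \<in> J" using yz by (auto simp: Y_def)
    have "(\<nexists>p. p \<in> A \<and> (\<forall>v\<in>J. x p < v)) \<or> (\<nexists>p. p \<in> A \<and> (\<forall>v\<in>J. v < x p))"
      using 4(2) by (auto simp: c_def cuts_def of_bool_def split: if_splits)
    then have "left A z \<subseteq> {p \<in> A. x p \<in> J} \<or> right A y \<subseteq> {p \<in> A. x p \<in> J}"
    proof
      assume no: "\<nexists>p. p \<in> A \<and> (\<forall>v\<in>J. x p < v)"
      have "x p \<in> J" if p: "p \<in> left A z" for p
      proof -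
        obtain v where "v \<in> J" "v \<le> x p"
          using no p left_subset[of A z] by (meson not_less subsetD)
        then show ?thesis
          using order_convexD[OF assms(6) _ J(2)] p by (auto simp: left_of_def)
      qed
      then show ?thesis by (auto simp: left_of_def)
    next
      assume no: "\<nexists>p. p \<in> A \<and> (\<forall>v\<in>J. v < x p)"
      have "x p \<in> J" if p: "p \<in> right A y" for p
      proof -
        obtain v where "v \<in> J" "x p \<le> v"
          using no p right_subset[of A y] by (meson not_less subsetD)
        then show ?thesis
          using order_convexD[OF assms(6) J(1)] p by (auto simp: right_of_def)
      qed
      then show ?thesis by (auto simp: right_of_def)
    qed
    then have "card (left A z) \<le> n \<or> card (right A y) \<le> n"
      unfolding n_def using fin by (auto intro!: card_mono)
    then have "win \<le> n" using large by linarith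
    then show ?thesis using early_bound_ge[of 1 n c] 4 by simp
  next
    case 5
    then have "1 \<le> n" using Yn by linarith
    then show ?thesis using early_bound_ge[of 0 n c] 5 Y2 by simp
  qed
  then show ?thesis by (simp add: Y_def n_def c_def)
qed

text \<open>
  At time \<open>c\<close> the gap is either still unsplit, and then the selected points among those present
  are sparse, or it has been split at a point inserted by then, and the bounds for the two sides
  add up.
\<close>
lemma selects_early_card:
  assumes "selects P G X" and "G \<subseteq> V" and "initial P G" and "order_convex J"
    and "P \<subseteq> {p \<in> G. t p \<le> c}" and "L \<le> card {p \<in> G. t p \<le> c}"
  shows "2 * int (card {p \<in> X. x p \<in> J \<and> t p \<le> c}) + 2
    \<le> early_bound (card {p \<in> G. x p \<in> J \<and> t p \<le> c}) (cuts x J G)"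
  using assms
proof (induction rule: selects.induct)
  case (stop G P)
  have "L \<le> card {p \<in> G. x p \<in> J \<and> t p \<le> c}" if "cuts x J G = 0"
  proof -
    have "{p \<in> G. x p \<in> J \<and> t p \<le> c} = {p \<in> G. t p \<le> c}"
      using cuts_eq_0[OF stop.prems(3) that] by auto
    then show ?thesis using stop.prems(5) by simp
  qed
  then show ?case by (simp add: early_bound_ge_2[OF cuts_le_2])
next
  case (arrive p P G X)
  let ?A = "{p \<in> G. t p \<le> c}"
  show ?case
  proof (cases "?A = P")
    case True
    have XG: "X \<subseteq> G" using arrive.hyps(4) by (rule selects_subset)
    have "2 * int (card {p \<in> X \<inter> P. x p \<in> J}) + 2 \<le> early_bound (card {p \<in> P. x p \<in> J}) (cuts x J P)"
      using arrive.hyps(2,3) arrive.prems True by (intro sparse_interval_card) auto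
    also have "\<dots> \<le> early_bound (card {p \<in> P. x p \<in> J}) (cuts x J G)"
      using arrive.prems(2) by (intro early_bound_mono cuts_mono) (simp add: initial_def)
    also have "{p \<in> P. x p \<in> J} = {p \<in> G. x p \<in> J \<and> t p \<le> c}"
      unfolding True[symmetric] by auto
    also have "{p \<in> X \<inter> P. x p \<in> J} = {p \<in> X. x p \<in> J \<and> t p \<le> c}"
      unfolding True[symmetric] using XG by auto
    finally show ?thesis .
  next
    case False
    then obtain r where r: "r \<in> G" "t r \<le> c" "r \<notin> P" using arrive.prems(4) by auto
    have "t p \<le> c"
    proof (rule ccontr)
      assume "\<not> t p \<le> c"
      then have "t r \<le> t p" "r \<noteq> p" using r(2) by auto
      then show False using arrive.hyps(1) r by (auto simp: initial_def)
    qed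
    then have "insert p P \<subseteq> ?A"
      using arrive.prems(4) arrive.hyps(1) by (auto simp: initial_def)
    then show ?thesis using arrive.IH arrive.prems arrive.hyps(1) by simp
  qed
next
  case (split P G q X1 X2)
  let ?X = "insert q (X1 \<union> X2)"
  let ?Q = "\<lambda>p. x p \<in> J \<and> t p \<le> c"
  have qG: "q \<in> G" using split.hyps(1,4) by (auto simp: initial_def)
  have finG: "finite G" using split.prems(1) finite_V finite_subset by blast
  have sides: "left G q \<subseteq> V" "right G q \<subseteq> V"
    using split.prems(1) left_subset right_subset by blast+
  note G = card_split[OF split.prems(1) qG, of ?Q]
  note X = selects_split_cards[OF split.hyps(7,8) qG split.prems(1), of ?Q]
  have X12: "X1 \<subseteq> left G q" "X2 \<subseteq> right G q"
    using split.hyps(7,8) selects_subset by blast+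
  have early: "left P q \<subseteq> {p \<in> left G q. t p \<le> c}" "right P q \<subseteq> {p \<in> right G q. t p \<le> c}"
    using split.prems(4) by (auto simp: left_of_def right_of_def)
  have fin: "finite (left G q)" "finite (right G q)"
    using finG left_subset right_subset finite_subset by metis+
  have large: "L \<le> card {p \<in> left G q. t p \<le> c}" "L \<le> card {p \<in> right G q. t p \<le> c}"
    using card_mono[OF _ early(1)] card_mono[OF _ early(2)] fin split.hyps(5,6) by auto
  note IH1 = split.IH(1)[OF sides(1) initial_left[OF split.hyps(1)] split.prems(3) early(1) large(1)]
  note IH2 = split.IH(2)[OF sides(2) initial_right[OF split.hyps(1)] split.prems(3) early(2) large(2)]
  have q_early: "t q \<le> c" using split.prems(4) split.hyps(4) by blast
  show ?case
  proof (cases "x q \<in> J")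
    case True
    show ?thesis
      using IH1 IH2 True q_early
        early_bound_add[of "card {p \<in> left G q. ?Q p}" "cuts x J (left G q)"
          "card {p \<in> right G q. ?Q p}" "cuts x J (right G q)"]
      unfolding X G cuts_split[of q G x J, OF qG True] by simp
  next
    case False
    then consider "J \<subseteq> {..<x q}" | "J \<subseteq> {x q<..}"
      using order_convex_avoids[OF split.prems(3)] by blast
    then show ?thesis
    proof cases
      case 1
      then have none: "{p \<in> X2. ?Q p} = {}" "{p \<in> right G q. ?Q p} = {}"
        using X12(2) by (force simp: right_of_def)+
      then show ?thesis
        using order_trans[OF IH1 early_bound_mono[OF cuts_mono[OF left_subset]]]
        unfolding X G none
        by (simp only: card.empty False simp_thms of_bool_eq add_0_left add_0_right)
    next
      case 2
      then have none: "{p \<in> X1. ?Q p} = {}" "{p \<in> left G q. ?Q p} = {}"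
        using X12(1) by (force simp: left_of_def)+
      then show ?thesis
        using order_trans[OF IH2 early_bound_mono[OF cuts_mono[OF right_subset]]]
        unfolding X G none
        by (simp only: card.empty False simp_thms of_bool_eq add_0_left add_0_right)
    qed
  qed
qed

section \<open>Both kinds of edges together\<close>

lemma one_sided_hitting_set:
  "\<exists>X\<subseteq>V.
    (\<forall>J c. order_convex J \<longrightarrow> card {p \<in> V. x p \<in> J \<and> t p \<le> c} = m \<longrightarrow>
      (\<exists>p\<in>X. x p \<in> J \<and> t p \<le> c) \<and> card {p \<in> X. x p \<in> J \<and> t p \<le> c} \<le> 9) \<and>
    (\<forall>J c. order_convex J \<longrightarrow> card {p \<in> V. x p \<in> J \<and> c \<le> t p} = m \<longrightarrow>
      card {p \<in> X. x p \<in> J \<and> c \<le> t p} \<le> 12)"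
proof -
  have init: "initial {} V" by (simp add: initial_def)
  have "hits {} {}" by (simp add: hits_def)
  then obtain X where X: "selects {} V X"
    using selects_exists[OF subset_refl init, of "{}"] by auto
  have "(\<exists>p\<in>X. x p \<in> J \<and> t p \<le> c) \<and> card {p \<in> X. x p \<in> J \<and> t p \<le> c} \<le> 9"
    if J: "order_convex J" and m: "card {p \<in> V. x p \<in> J \<and> t p \<le> c} = m" for J c
  proof -
    have "card {p \<in> V. x p \<in> J \<and> t p \<le> c} \<le> card {p \<in> V. t p \<le> c}"
      using finite_V by (intro card_mono) auto
    then have "L \<le> card {p \<in> V. t p \<le> c}" using m m_lower by linarith
    then have "2 * int (card {p \<in> X. x p \<in> J \<and> t p \<le> c}) + 2 \<le> early_bound m (cuts x J V)"
      using selects_early_card[OF X subset_refl init J, of c] m by simp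
    then show ?thesis
      using early_bound_edge[OF cuts_le_2, of x J V] selects_hit[OF X subset_refl J m] by linarith
  qed
  moreover have "card {p \<in> X. x p \<in> J \<and> c \<le> t p} \<le> 12"
    if J: "order_convex J" and m: "card {p \<in> V. x p \<in> J \<and> c \<le> t p} = m" for J c
  proof (rule ccontr)
    assume "\<not> ?thesis"
    then have "13 * (L + 1) \<le> card {p \<in> X. x p \<in> J \<and> c \<le> t p} * (L + 1)"
      by (intro mult_le_mono1) simp
    also have "\<dots> \<le> m + cuts x J V * (4 * L)"
    proof -
      have "card {p \<in> V. x p \<in> J \<and> c \<le> t p} \<le> card V"
        using finite_V by (intro card_mono) auto
      then have "L \<le> card V" using m m_lower by linarith
      then show ?thesis using selects_late_card[OF X subset_refl J, of c] m by simp
    qed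
    also have "\<dots> \<le> m + 2 * (4 * L)"
      by (intro add_left_mono mult_le_mono1 cuts_le_2)
    finally show False using m_upper by simp
  qed
  ultimately show ?thesis using selects_subset[OF X] by blast
qed

end

theorem theorem25:
  fixes m :: nat and V :: "point set"
  assumes "m \<ge> 1" and "finite V" and "general_position V"
  shows "\<exists>X. shallow_hitting_set 21
    (range_hypergraph V (bottomless_rectangles \<union> topless_rectangles) m) X"
proof -
  have inj: "inj_on fst V" "inj_on snd V" "inj_on (\<lambda>p. - snd p) V"
    using assms(3) by (auto simp: general_position_def inj_on_def)
  define L where "L = (m - 1) div 5"
  have L: "5 * L + 1 \<le> m" "m \<le> 5 * L + 5" using assms(1) by (auto simp: L_def)
  interpret up: insertion_order fst snd V m L
    using assms(2) inj L by unfold_locales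
  interpret down: insertion_order fst "\<lambda>p. - snd p" V m L
    using assms(2) inj L by unfold_locales
  obtain A where A: "A \<subseteq> V"
    and A_early: "\<And>J c. order_convex J \<Longrightarrow> card {p \<in> V. fst p \<in> J \<and> snd p \<le> c} = m \<Longrightarrow>
      (\<exists>p\<in>A. fst p \<in> J \<and> snd p \<le> c) \<and> card {p \<in> A. fst p \<in> J \<and> snd p \<le> c} \<le> 9"
    and A_late: "\<And>J c. order_convex J \<Longrightarrow> card {p \<in> V. fst p \<in> J \<and> c \<le> snd p} = m \<Longrightarrow>
      card {p \<in> A. fst p \<in> J \<and> c \<le> snd p} \<le> 12"
    using up.one_sided_hitting_set by blast
  obtain B where B: "B \<subseteq> V"
    and B_early: "\<And>J c. order_convex J \<Longrightarrow> card {p \<in> V. fst p \<in> J \<and> - snd p \<le> c} = m \<Longrightarrow>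
      (\<exists>p\<in>B. fst p \<in> J \<and> - snd p \<le> c) \<and> card {p \<in> B. fst p \<in> J \<and> - snd p \<le> c} \<le> 9"
    and B_late: "\<And>J c. order_convex J \<Longrightarrow> card {p \<in> V. fst p \<in> J \<and> c \<le> - snd p} = m \<Longrightarrow>
      card {p \<in> B. fst p \<in> J \<and> c \<le> - snd p} \<le> 12"
    using down.one_sided_hitting_set by blast
  have conv: "order_convex {a..b}" for a b :: real
    by (auto simp: order_convex_def)
  have "1 \<le> card (e \<inter> (A \<union> B)) \<and> card (e \<inter> (A \<union> B)) \<le> 21"
    if e: "card e = m" "R \<in> bottomless_rectangles \<union> topless_rectangles" "e = V \<inter> R" for e R
  proof -
    have fin: "finite e" using e(3) assms(2) by simp
    have "(\<exists>p\<in>A \<union> B. p \<in> e) \<and> card (e \<inter> A) + card (e \<inter> B) \<le> 21"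
      using e(2)
    proof
      assume "R \<in> bottomless_rectangles"
      then obtain a b c where R: "R = {a..b} \<times> {..c}"
        by (auto simp: bottomless_rectangles_def)
      have *: "V \<inter> R = {p \<in> V. fst p \<in> {a..b} \<and> snd p \<le> c}"
        "e \<inter> A = {p \<in> A. fst p \<in> {a..b} \<and> snd p \<le> c}"
        "e \<inter> B = {p \<in> B. fst p \<in> {a..b} \<and> - c \<le> - snd p}"
        using A B e(3) by (auto simp: R mem_Times_iff)
      have "card {p \<in> V. fst p \<in> {a..b} \<and> snd p \<le> c} = m" using e(1,3) * by simp
      then show ?thesis
        using A_early[OF conv, of a b c] B_late[OF conv, of a b "- c"] * by auto
    next
      assume "R \<in> topless_rectangles"
      then obtain a b c where R: "R = {a..b} \<times> {c..}"
        by (auto simp: topless_rectangles_def)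
      have *: "V \<inter> R = {p \<in> V. fst p \<in> {a..b} \<and> c \<le> snd p}"
        "e \<inter> A = {p \<in> A. fst p \<in> {a..b} \<and> c \<le> snd p}"
        "e \<inter> B = {p \<in> B. fst p \<in> {a..b} \<and> - snd p \<le> - c}"
        using A B e(3) by (auto simp: R mem_Times_iff)
      have "card {p \<in> V. fst p \<in> {a..b} \<and> c \<le> snd p} = m" using e(1,3) * by simp
      then show ?thesis
        using A_late[OF conv, of a b c] B_early[OF conv, of a b "- c"] * by auto
    qed
    moreover have "card (e \<inter> (A \<union> B)) \<le> card (e \<inter> A) + card (e \<inter> B)"
      by (simp add: Int_Un_distrib card_Un_le)
    moreover have "1 \<le> card (e \<inter> (A \<union> B))" if "\<exists>p\<in>A \<union> B. p \<in> e"
    proof -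
      have "e \<inter> (A \<union> B) \<noteq> {}" using that by blast
      then show ?thesis using fin by (simp add: Suc_le_eq card_gt_0_iff)
    qed
    ultimately show ?thesis by linarith
  qed
  then have "shallow_hitting_set 21
      (range_hypergraph V (bottomless_rectangles \<union> topless_rectangles) m) (A \<union> B)"
    using A B by (auto simp: shallow_hitting_set_def range_hypergraph_def)
  then show ?thesis by blast
qed

end
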